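(* Let $\mathbb{M}$, $\mathbb{J}$, $\mathbb{D}$ be classes of filters with $\mathbb{M}\subset\mathbb{J}$. Let $(X,\xi)$ and $(Y,\tau)$ be convergence spaces with $\tau=\mathrm{Adh}_{\mathbb{M}}\tau$, and let $f:(X,\xi)\to(Y,\tau)$ be a continuous surjection. Then $f$ is $\mathbb{M}$-quotient and its range $(Y,\tau)$ is $(\mathbb{J}/\mathbb{D})$-accessible if and only if $f:(X,f^{-}\tau)\to(Y,f\xi)$ is an $\mathbb{M}$-compactly $(\mathbb{J}/\mathbb{D})$-meshable relation.
   Context: Filters and classes. For filters, $\mathcal{F}\leq\mathcal{G}$ means $\mathcal{F}\subset\mathcal{G}$. Families $\mathcal{A},\mathcal{B}$ of subsets of a set mesh, $\mathcal{A}\#\mathcal{B}$, if $A\cap B\neq\emptyset$ for all $A\in\mathcal{A}$, $B\in\mathcal{B}$. $\mathcal{A}^{\uparrow}$ is the family of supersets of members of $\mathcal{A}$. A class of filters $\mathbb{D}$ assigns to each set $X$ a collection $\mathbb{D}(X)$ of filters on $X$; by convention every class contains the degenerate filter $2^X$. $\mathbb{M}\subset\mathbb{J}$ means $\mathbb{M}(X)\subset\mathbb{J}(X)$ for every $X$. Convergence spaces. A convergence $\xi$ on $X$ is a relation between (proper) filters on $X$ and points of $X$, written $x\in\lim_\xi\mathcal{F}$, such that $\mathcal{F}\leq\mathcal{G}$ implies $\lim_\xi\mathcal{F}\subset\lim_\xi\mathcal{G}$; $x\in\lim_\xi\{x\}^{\uparrow}$ for all $x$; and $\lim_\xi(\mathcal{F}\wedge\mathcal{G})=\lim_\xi\mathcal{F}\cap\lim_\xi\mathcal{G}$,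 where $\mathcal{F}\wedge\mathcal{G}=\mathcal{F}\cap\mathcal{G}$. A map $f:(X,\xi)\to(Y,\tau)$ is continuous if $f(\lim_\xi\mathcal{F})\subset\lim_\tau f(\mathcal{F})$ for all $\mathcal{F}$. A convergence $\xi$ is finer than $\theta$ if $\lim_\xi\mathcal{F}\subset\lim_\theta\mathcal{F}$ for all $\mathcal{F}$. $f\xi$ (final convergence) is the finest convergence on $Y$ making $f:(X,\xi)\to Y$ continuous; $f^{-}\tau$ (initial convergence) is the coarsest convergence on $X$ making $f:X\to(Y,\tau)$ continuous. $\mathrm{adh}_\xi\mathcal{F}=\bigcup_{\mathcal{G}\#\mathcal{F}}\lim_\xi\mathcal{G}$. $\lim_{\mathrm{Adh}_{\mathbb{M}}\xi}\mathcal{F}=\bigcap\{\mathrm{adh}_\xi\mathcal{D}:\mathcal{D}\in\mathbb{M}(X),\ \mathcal{D}\#\mathcal{F}\}$ and $\lim_{\mathrm{Base}_{\mathbb{D}}\xi}\mathcal{F}=\bigcup\{\lim_\xi\mathcal{D}:\mathcal{D}\in\mathbb{D}(X),\ \mathcal{D}\leq\mathcal{F}\}$. $(X,\xi)$ is $(\mathbb{J}/\mathbb{D})$-accessible if $\mathrm{adh}_\xi\mathcal{J}\subset\mathrm{adh}_{\mathrm{Base}_{\mathbb{D}}\xi}\mathcal{J}$ for every $\mathcal{J}\in\mathbb{J}(X)$ (adherence for $\mathrm{Base}_{\mathbb{D}}\xi$ defined by the same formula). Compactness. A filter $\mathcal{F}$ is $\mathbb{M}$-compact at $A\subset X$ (for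 $\xi$) if $\mathcal{M}\in\mathbb{M}(X)$, $\mathcal{M}\#\mathcal{F}$ imply $\mathrm{adh}_\xi\mathcal{M}\cap A\neq\emptyset$. $\mathcal{F}$ is $\mathbb{M}$-compactly $(\mathbb{J}/\mathbb{D})$-meshable at $A$ (for $\xi$) if for every $\mathcal{J}\in\mathbb{J}(X)$ with $\mathcal{J}\#\mathcal{F}$ there is $\mathcal{D}\in\mathbb{D}(X)$ with $\mathcal{D}\#\mathcal{J}$ and $\mathcal{D}$ $\mathbb{M}$-compact at $A$. A relation $R:(X,\xi)\rightrightarrows(Y,\tau)$ is $\mathbb{M}$-compactly $(\mathbb{J}/\mathbb{D})$-meshable if whenever $x\in\lim_\xi\mathcal{F}$, the filter $R\mathcal{F}$ generated by $\{RF:F\in\mathcal{F}\}$ is $\mathbb{M}$-compactly $(\mathbb{J}/\mathbb{D})$-meshable at $Rx$ for $\tau$. A map is regarded as a relation. A surjection $f:(X,\xi)\to(Y,\tau)$ is $\mathbb{M}$-quotient if for every $\mathcal{H}\in\mathbb{M}(Y)$ and $y\in Y$: $y\in\mathrm{adh}_\tau\mathcal{H}$ implies $f^{-}(y)\cap\mathrm{adh}_\xi f^{-}\mathcal{H}\neq\emptyset$, where $f^{-}$ denotes preimage and $f^{-}\mathcal{H}$ is the filter generated by $\{f^{-}(H):H\in\mathcal{H}\}$. *)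

theory Defs
  imports Complex_Main
begin

text \<open>
  A filter on a set \<open>X\<close> is a library filter \<open>F\<close> with \<open>F \<le> principal X\<close>; the corresponding
  family of subsets of \<open>X\<close> is \<open>{A. A \<subseteq> X \<and> eventually (\<lambda>x. x \<in> A) F}\<close>. The library order is the
  reverse of inclusion of these families: \<open>F \<subseteq> G\<close> as families is \<open>G \<le> F\<close> here, the
  degenerate filter \<open>2\<^sup>X\<close> is \<open>bot\<close>, and the intersection of families is \<open>sup\<close>.
\<close>

definition filter_on :: "'a set \<Rightarrow> 'a filter \<Rightarrow> bool" where
  "filter_on X F \<longleftrightarrow> F \<le> principal X"

definition proper_filter_on :: "'a set \<Rightarrow> 'a filter \<Rightarrow> bool" where
  "proper_filter_on X F \<longleftrightarrow> filter_on X F \<and> F \<noteq> bot"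

definition mesh :: "'a filter \<Rightarrow> 'a filter \<Rightarrow> bool" where
  "mesh F G \<longleftrightarrow>
     (\<forall>A B. eventually (\<lambda>x. x \<in> A) F \<longrightarrow> eventually (\<lambda>x. x \<in> B) G \<longrightarrow> A \<inter> B \<noteq> {})"


text \<open>A class of filters assigns a collection of filters to every set \<open>X\<close> over the given type.\<close>

type_synonym 'a filter_class = "'a set \<Rightarrow> 'a filter set"

definition is_filter_class :: "'a filter_class \<Rightarrow> bool" where
  "is_filter_class \<D> \<longleftrightarrow> (\<forall>X. bot \<in> \<D> X \<and> (\<forall>F \<in> \<D> X. filter_on X F))"

definition subclass_of :: "'a filter_class \<Rightarrow> 'a filter_class \<Rightarrow> bool" where
  "subclass_of \<M> \<J> \<longleftrightarrow> (\<forall>X. \<M> X \<subseteq> \<J> X)"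


text \<open>
  A convergence is given by its limit operator. Since it relates only proper filters on \<open>X\<close> to
  points, the limit operator is taken to be empty at every other filter over the type; thus two
  convergences on \<open>X\<close> are equal iff they are equal as functions, and no restriction to proper
  filters on \<open>X\<close> is needed when quantifying over convergent filters.
\<close>

type_synonym 'a convergence = "'a filter \<Rightarrow> 'a set"

definition convergence_on :: "'a set \<Rightarrow> 'a convergence \<Rightarrow> bool" where
  "convergence_on X \<xi> \<longleftrightarrow>
     (\<forall>F. \<xi> F \<subseteq> X) \<and>
     (\<forall>F. \<not> proper_filter_on X F \<longrightarrow> \<xi> F = {}) \<and>
     (\<forall>F G. proper_filter_on X F \<longrightarrow> proper_filter_on X G \<longrightarrow> G \<le> F \<longrightarrow> \<xi> F \<subseteq> \<xi> G) \<and>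
     (\<forall>x\<in>X. x \<in> \<xi> (principal {x})) \<and>
     (\<forall>F G. proper_filter_on X F \<longrightarrow> proper_filter_on X G \<longrightarrow> \<xi> (sup F G) = \<xi> F \<inter> \<xi> G)"

definition conv_continuous ::
    "'a set \<Rightarrow> 'a convergence \<Rightarrow> 'b set \<Rightarrow> 'b convergence \<Rightarrow> ('a \<Rightarrow> 'b) \<Rightarrow> bool" where
  "conv_continuous X \<xi> Y \<tau> f \<longleftrightarrow>
     f ` X \<subseteq> Y \<and> (\<forall>F. proper_filter_on X F \<longrightarrow> f ` \<xi> F \<subseteq> \<tau> (filtermap f F))"

definition finer :: "'a convergence \<Rightarrow> 'a convergence \<Rightarrow> bool" where
  "finer \<xi> \<theta> \<longleftrightarrow> (\<forall>F. \<xi> F \<subseteq> \<theta> F)"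

definition is_final_convergence ::
    "'a set \<Rightarrow> 'a convergence \<Rightarrow> 'b set \<Rightarrow> ('a \<Rightarrow> 'b) \<Rightarrow> 'b convergence \<Rightarrow> bool" where
  "is_final_convergence X \<xi> Y f \<theta> \<longleftrightarrow>
     convergence_on Y \<theta> \<and> conv_continuous X \<xi> Y \<theta> f \<and>
     (\<forall>\<theta>'. convergence_on Y \<theta>' \<longrightarrow> conv_continuous X \<xi> Y \<theta>' f \<longrightarrow> finer \<theta> \<theta>')"

definition final_convergence ::
    "'a set \<Rightarrow> 'a convergence \<Rightarrow> 'b set \<Rightarrow> ('a \<Rightarrow> 'b) \<Rightarrow> 'b convergence" where
  "final_convergence X \<xi> Y f = (THE \<theta>. is_final_convergence X \<xi> Y f \<theta>)"

definition is_initial_convergence ::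
    "'a set \<Rightarrow> 'b set \<Rightarrow> 'b convergence \<Rightarrow> ('a \<Rightarrow> 'b) \<Rightarrow> 'a convergence \<Rightarrow> bool" where
  "is_initial_convergence X Y \<tau> f \<theta> \<longleftrightarrow>
     convergence_on X \<theta> \<and> conv_continuous X \<theta> Y \<tau> f \<and>
     (\<forall>\<theta>'. convergence_on X \<theta>' \<longrightarrow> conv_continuous X \<theta>' Y \<tau> f \<longrightarrow> finer \<theta>' \<theta>)"

definition initial_convergence ::
    "'a set \<Rightarrow> 'b set \<Rightarrow> 'b convergence \<Rightarrow> ('a \<Rightarrow> 'b) \<Rightarrow> 'a convergence" where
  "initial_convergence X Y \<tau> f = (THE \<theta>. is_initial_convergence X Y \<tau> f \<theta>)"

definition adh :: "'a convergence \<Rightarrow> 'a filter \<Rightarrow> 'a set" where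
  "adh \<xi> F = (\<Union>G \<in> {G. mesh G F}. \<xi> G)"

text \<open>An intersection over an empty family of subsets of \<open>X\<close> is \<open>X\<close>.\<close>

definition Adh :: "'a set \<Rightarrow> 'a filter_class \<Rightarrow> 'a convergence \<Rightarrow> 'a convergence" where
  "Adh X \<M> \<xi> F =
     (if proper_filter_on X F then X \<inter> (\<Inter>D \<in> {D \<in> \<M> X. mesh D F}. adh \<xi> D) else {})"

definition Base :: "'a set \<Rightarrow> 'a filter_class \<Rightarrow> 'a convergence \<Rightarrow> 'a convergence" where
  "Base X \<D> \<xi> F =
     (if proper_filter_on X F then (\<Union>D \<in> {D \<in> \<D> X. F \<le> D}. \<xi> D) else {})"

definition accessible ::
    "'a filter_class \<Rightarrow> 'a filter_class \<Rightarrow> 'a set \<Rightarrow> 'a convergence \<Rightarrow> bool" where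
  "accessible \<J> \<D> X \<xi> \<longleftrightarrow> (\<forall>J \<in> \<J> X. adh \<xi> J \<subseteq> adh (Base X \<D> \<xi>) J)"

definition compact_at ::
    "'a filter_class \<Rightarrow> 'a set \<Rightarrow> 'a convergence \<Rightarrow> 'a filter \<Rightarrow> 'a set \<Rightarrow> bool" where
  "compact_at \<M> X \<xi> F A \<longleftrightarrow> (\<forall>M \<in> \<M> X. mesh M F \<longrightarrow> adh \<xi> M \<inter> A \<noteq> {})"

definition compactly_meshable_at ::
    "'a filter_class \<Rightarrow> 'a filter_class \<Rightarrow> 'a filter_class \<Rightarrow>
     'a set \<Rightarrow> 'a convergence \<Rightarrow> 'a filter \<Rightarrow> 'a set \<Rightarrow> bool" where
  "compactly_meshable_at \<M> \<J> \<D> X \<xi> F A \<longleftrightarrow>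
     (\<forall>J \<in> \<J> X. mesh J F \<longrightarrow> (\<exists>D \<in> \<D> X. mesh D J \<and> compact_at \<M> X \<xi> D A))"

text \<open>The infimum of principal filters is the filter generated by the underlying sets.\<close>

definition rel_filter_image :: "('a \<times> 'b) set \<Rightarrow> 'a filter \<Rightarrow> 'b filter" where
  "rel_filter_image R F = (INF A \<in> {A. eventually (\<lambda>x. x \<in> A) F}. principal (R `` A))"

definition compactly_meshable_rel ::
    "'b filter_class \<Rightarrow> 'b filter_class \<Rightarrow> 'b filter_class \<Rightarrow>
     'a set \<Rightarrow> 'a convergence \<Rightarrow> 'b set \<Rightarrow> 'b convergence \<Rightarrow> ('a \<times> 'b) set \<Rightarrow> bool" where
  "compactly_meshable_rel \<M> \<J> \<D> X \<xi> Y \<tau> R \<longleftrightarrow>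
     R \<subseteq> X \<times> Y \<and>
     (\<forall>F x. x \<in> \<xi> F \<longrightarrow>
        compactly_meshable_at \<M> \<J> \<D> Y \<tau> (rel_filter_image R F) (R `` {x}))"

definition graph_on :: "'a set \<Rightarrow> ('a \<Rightarrow> 'b) \<Rightarrow> ('a \<times> 'b) set" where
  "graph_on X f = {(x, f x) | x. x \<in> X}"

text \<open>The filter on \<open>X\<close> generated by the preimages \<open>{x \<in> X. f x \<in> B}\<close> of the members \<open>B\<close> of \<open>H\<close>.\<close>

definition preimage_filter :: "'a set \<Rightarrow> ('a \<Rightarrow> 'b) \<Rightarrow> 'b filter \<Rightarrow> 'a filter" where
  "preimage_filter X f H = inf (filtercomap f H) (principal X)"

definition quotient_map_for ::
    "'b filter_class \<Rightarrow> 'a set \<Rightarrow> 'a convergence \<Rightarrow> 'b set \<Rightarrow> 'b convergence \<Rightarrow>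
     ('a \<Rightarrow> 'b) \<Rightarrow> bool" where
  "quotient_map_for \<M> X \<xi> Y \<tau> f \<longleftrightarrow>
     f ` X = Y \<and>
     (\<forall>H \<in> \<M> Y. \<forall>y \<in> Y. y \<in> adh \<tau> H \<longrightarrow>
        (X \<inter> f -` {y}) \<inter> adh \<xi> (preimage_filter X f H) \<noteq> {})"


text \<open>The finest, respectively coarsest, convergence making \<open>f\<close> continuous exists and is unique.\<close>

lemma is_final_convergence_unique:
  assumes "is_final_convergence X \<xi> Y f \<theta>" "is_final_convergence X \<xi> Y f \<theta>'"
  shows "\<theta> = \<theta>'"
  using assms unfolding is_final_convergence_def finer_def by (meson ext subset_antisym)

lemma is_initial_convergence_unique:
  assumes "is_initial_convergence X Y \<tau> f \<theta>" "is_initial_convergence X Y \<tau> f \<theta>'"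
  shows "\<theta> = \<theta>'"
  using assms unfolding is_initial_convergence_def finer_def by (meson ext subset_antisym)

lemma proper_filter_on_sup:
  "proper_filter_on X F \<Longrightarrow> proper_filter_on X G \<Longrightarrow> proper_filter_on X (sup F G)"
  by (auto simp: proper_filter_on_def filter_on_def)

lemma proper_filter_on_principal_singleton: "x \<in> X \<Longrightarrow> proper_filter_on X (principal {x})"
  by (auto simp: proper_filter_on_def filter_on_def principal_eq_bot_iff)

lemma proper_filter_on_filtermap:
  assumes "f ` X \<subseteq> Y" "proper_filter_on X F"
  shows "proper_filter_on Y (filtermap f F)"
proof -
  have "filtermap f F \<le> filtermap f (principal X)"
    using assms(2) by (intro filtermap_mono) (simp add: proper_filter_on_def filter_on_def)
  also have "\<dots> \<le> principal Y" using assms(1) by (auto simp: le_principal eventually_filtermap eventually_principal)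
  finally show ?thesis
    using assms(2) by (simp add: proper_filter_on_def filter_on_def filtermap_bot_iff)
qed

lemma is_final_convergence_final_convergence:
  assumes "convergence_on X \<xi>" and f: "f ` X \<subseteq> Y"
  shows "is_final_convergence X \<xi> Y f (final_convergence X \<xi> Y f)"
proof -
  define C where "C = {\<theta>. convergence_on Y \<theta> \<and> conv_continuous X \<xi> Y \<theta> f}"
  let ?\<theta> = "\<lambda>F. \<Inter>\<theta>\<in>C. \<theta> F"
  let ?\<iota> = "\<lambda>F. if proper_filter_on Y F then Y else {}"
  have \<xi>X: "\<And>F. \<xi> F \<subseteq> X" using assms(1) by (auto simp: convergence_on_def)
  have "convergence_on Y ?\<iota>"
    by (auto simp: convergence_on_def proper_filter_on_sup proper_filter_on_principal_singleton)
  moreover have "conv_continuous X \<xi> Y ?\<iota> f"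
    using f \<xi>X by (auto simp: conv_continuous_def proper_filter_on_filtermap)
  ultimately have \<iota>: "?\<iota> \<in> C" unfolding C_def by blast
  have sub: "?\<theta> F \<subseteq> ?\<iota> F" for F using \<iota> by blast
  have conv: "convergence_on Y ?\<theta>"
    unfolding convergence_on_def
  proof (intro conjI allI impI ballI)
    show "?\<theta> F \<subseteq> Y" for F using sub[of F] by (auto split: if_splits)
    show "?\<theta> F = {}" if "\<not> proper_filter_on Y F" for F
    proof -
      have "?\<iota> F = {}" using that by simp
      with sub[of F] show ?thesis by blast
    qed
    show "?\<theta> F \<subseteq> ?\<theta> G"
      if "proper_filter_on Y F" "proper_filter_on Y G" "G \<le> F" for F G
    proof -
      have "\<theta> F \<subseteq> \<theta> G" if "\<theta> \<in> C" for \<theta>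
        using that \<open>proper_filter_on Y F\<close> \<open>proper_filter_on Y G\<close> \<open>G \<le> F\<close>
        by (simp add: C_def convergence_on_def)
      then show ?thesis by blast
    qed
    show "y \<in> ?\<theta> (principal {y})" if "y \<in> Y" for y
      using that by (simp add: C_def convergence_on_def)
    show "?\<theta> (sup F G) = ?\<theta> F \<inter> ?\<theta> G"
      if "proper_filter_on Y F" "proper_filter_on Y G" for F G
    proof -
      have "\<theta> (sup F G) = \<theta> F \<inter> \<theta> G" if "\<theta> \<in> C" for \<theta>
        using that \<open>proper_filter_on Y F\<close> \<open>proper_filter_on Y G\<close> by (simp add: C_def convergence_on_def)
      then have "?\<theta> (sup F G) = (\<Inter>\<theta>\<in>C. \<theta> F \<inter> \<theta> G)" by (intro INF_cong) auto
      then show ?thesis by (simp only: INT_Int_distrib)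
    qed
  qed
  have "is_final_convergence X \<xi> Y f ?\<theta>"
    unfolding is_final_convergence_def
  proof (intro conjI conv allI impI)
    show "conv_continuous X \<xi> Y ?\<theta> f" using f by (simp add: C_def conv_continuous_def) blast
    show "finer ?\<theta> \<theta>'" if "convergence_on Y \<theta>'" "conv_continuous X \<xi> Y \<theta>' f" for \<theta>'
      using that by (auto simp: C_def finer_def)
  qed
  then show ?thesis
    unfolding final_convergence_def
    by (intro theI[of "is_final_convergence X \<xi> Y f"] is_final_convergence_unique)
qed

lemma is_initial_convergence_initial_convergence:
  assumes \<tau>: "convergence_on Y \<tau>" and f: "f ` X \<subseteq> Y"
  shows "is_initial_convergence X Y \<tau> f (initial_convergence X Y \<tau> f)"
proof -
  let ?\<theta> = "\<lambda>F. if proper_filter_on X F then {x \<in> X. f x \<in> \<tau> (filtermap f F)} else {}"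
  have conv: "convergence_on X ?\<theta>"
    unfolding convergence_on_def
  proof (intro conjI allI impI ballI)
    show "?\<theta> F \<subseteq> X" for F by auto
    show "?\<theta> F = {}" if "\<not> proper_filter_on X F" for F using that by auto
    show "?\<theta> F \<subseteq> ?\<theta> G" if "proper_filter_on X F" "proper_filter_on X G" "G \<le> F" for F G
    proof -
      have "\<tau> (filtermap f F) \<subseteq> \<tau> (filtermap f G)"
        using \<tau> that f proper_filter_on_filtermap[OF f] filtermap_mono[OF that(3), of f]
        by (simp add: convergence_on_def)
      then show ?thesis using that by auto
    qed
    show "x \<in> ?\<theta> (principal {x})" if "x \<in> X" for x
      using that \<tau> f by (auto simp: convergence_on_def proper_filter_on_principal_singleton)
    show "?\<theta> (sup F G) = ?\<theta> F \<inter> ?\<theta> G" if "proper_filter_on X F" "proper_filter_on X G" for F G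
    proof -
      have "\<tau> (filtermap f (sup F G)) = \<tau> (filtermap f F) \<inter> \<tau> (filtermap f G)"
        using \<tau> that proper_filter_on_filtermap[OF f]
        by (simp add: convergence_on_def filtermap_sup)
      then show ?thesis using that by (auto simp: proper_filter_on_sup)
    qed
  qed
  have "is_initial_convergence X Y \<tau> f ?\<theta>"
    unfolding is_initial_convergence_def
  proof (intro conjI conv allI impI)
    show "conv_continuous X ?\<theta> Y \<tau> f" using f by (auto simp: conv_continuous_def)
    show "finer \<theta>' ?\<theta>" if "convergence_on X \<theta>'" "conv_continuous X \<theta>' Y \<tau> f" for \<theta>'
      unfolding finer_def
    proof (intro allI)
      show "\<theta>' F \<subseteq> ?\<theta> F" for F
      proof (cases "proper_filter_on X F")
        case True
        moreover have "\<theta>' F \<subseteq> X" using that(1) by (auto simp: convergence_on_def)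
        moreover have "f ` \<theta>' F \<subseteq> \<tau> (filtermap f F)"
          using that(2) True by (simp add: conv_continuous_def)
        ultimately show ?thesis by auto
      next
        case False
        then show ?thesis using that(1) by (auto simp: convergence_on_def)
      qed
    qed
  qed
  then show ?thesis
    unfolding initial_convergence_def
    by (intro theI[of "is_initial_convergence X Y \<tau> f"] is_initial_convergence_unique)
qed

end

(*
  The convergence f \<xi> satisfies adh_{f \<xi>} H = f (adh_\<xi> (f\<^sup>- H)), so f is M-quotient iff
  adh_\<tau> H is contained in adh_{f \<xi>} H for every H in M. Both implications then compare points:
  since \<tau> = Adh_M \<tau>, a filter D that is M-compact at {y} for the finer f \<xi> converges to y in \<tau>,
  and conversely, for M-quotient f, every filter converging to y in \<tau> is M-compact at {y} for f \<xi>.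
*)
theory Submission
  imports Defs
begin

section \<open>Meshing, images and preimages of filters\<close>

lemma mesh_iff_inf_neq_bot: "mesh F G \<longleftrightarrow> inf F G \<noteq> bot"
proof -
  have "inf F G = bot \<longleftrightarrow>
      (\<exists>P Q. eventually P F \<and> eventually Q G \<and> (\<forall>x. \<not> (P x \<and> Q x)))"
    by (simp add: trivial_limit_def eventually_inf)
  also have "\<dots> \<longleftrightarrow> \<not> mesh F G"
  proof
    assume "\<exists>P Q. eventually P F \<and> eventually Q G \<and> (\<forall>x. \<not> (P x \<and> Q x))"
    then obtain P Q where "eventually P F" "eventually Q G" "\<And>x. \<not> (P x \<and> Q x)" by blast
    then have "eventually (\<lambda>x. x \<in> {x. P x}) F" "eventually (\<lambda>x. x \<in> {x. Q x}) G"
      "{x. P x} \<inter> {x. Q x} = {}" by auto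
    then show "\<not> mesh F G" unfolding mesh_def by blast
  next
    assume "\<not> mesh F G"
    then show "\<exists>P Q. eventually P F \<and> eventually Q G \<and> (\<forall>x. \<not> (P x \<and> Q x))"
      unfolding mesh_def by (metis IntI emptyE)
  qed
  finally show ?thesis by blast
qed

lemma mesh_commute: "mesh F G \<longleftrightarrow> mesh G F"
  by (simp add: mesh_iff_inf_neq_bot inf_commute)

lemma mesh_mono: "mesh F G \<Longrightarrow> F \<le> F' \<Longrightarrow> mesh F' G"
  unfolding mesh_def le_filter_def by blast

lemma mesh_imp_neq_bot: "mesh F G \<Longrightarrow> F \<noteq> bot"
  by (auto simp: mesh_iff_inf_neq_bot)

text \<open>Distributivity of the filter lattice. It yields the axiom on \<open>sup\<close> for the
  auxiliary convergence in \<open>adh_final_convergence\<close>.\<close>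

lemma mesh_sup_left: "mesh (sup F G) H \<longleftrightarrow> mesh F H \<or> mesh G H"
  by (simp add: mesh_iff_inf_neq_bot inf_sup_distrib2)

text \<open>The projection formula \<open>filtermap f (inf F (filtercomap f H)) = inf (filtermap f
  F) H\<close>, combined with the fact that an image filter is \<open>bot\<close> only if the
  original is. As \<open>F\<close> lives on \<open>X\<close>, the restriction to \<open>X\<close> in
  \<open>preimage_filter\<close> is absorbed.\<close>

lemma mesh_filtermap_iff:
  assumes "F \<le> principal X"
  shows "mesh (filtermap f F) H \<longleftrightarrow> mesh F (preimage_filter X f H)"
proof -
  have "filtermap f (inf F (filtercomap f H)) = inf (filtermap f F) H"
  proof (rule antisym)
    show "filtermap f (inf F (filtercomap f H)) \<le> inf (filtermap f F) H"
      by (meson filtermap_inf filtermap_filtercomap inf_mono order_refl order_trans)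
    show "inf (filtermap f F) H \<le> filtermap f (inf F (filtercomap f H))"
    proof (rule filter_leI)
      fix P assume "eventually P (filtermap f (inf F (filtercomap f H)))"
      then obtain A B Q where A: "eventually A F" and Q: "eventually Q H"
        and B: "\<And>x. Q (f x) \<Longrightarrow> B x" and P: "\<And>x. A x \<Longrightarrow> B x \<Longrightarrow> P (f x)"
        unfolding eventually_filtermap eventually_inf eventually_filtercomap by blast
      \<comment> \<open>The implication holds at \<open>f x\<close> for every \<open>x\<close>
        satisfying \<open>A\<close>; meeting it with \<open>Q\<close> leaves
        \<open>P\<close>.\<close>
      have "eventually (\<lambda>y. Q y \<longrightarrow> P y) (filtermap f F)"
        unfolding eventually_filtermap using A by (rule eventually_mono) (blast intro: B P)
      with Q show "eventually P (inf (filtermap f F) H)"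
        unfolding eventually_inf by blast
    qed
  qed
  then have "mesh (filtermap f F) H \<longleftrightarrow> inf F (filtercomap f H) \<noteq> bot"
    by (metis mesh_iff_inf_neq_bot filtermap_bot_iff)
  moreover have "inf F (preimage_filter X f H) = inf F (filtercomap f H)"
    using assms by (metis preimage_filter_def inf.assoc inf.commute inf.absorb1)
  ultimately show ?thesis by (simp add: mesh_iff_inf_neq_bot)
qed

text \<open>Surjectivity loses no point of \<open>Y\<close>, so every filter on \<open>Y\<close>
  lifts to a filter on \<open>X\<close> that maps back onto it.\<close>

lemma filtermap_preimage_filter:
  assumes "f ` X = Y" "filter_on Y H"
  shows "filtermap f (preimage_filter X f H) = H"
proof (rule filter_eqI)
  fix P
  have Y: "eventually (\<lambda>y. y \<in> Y) H"
    using assms(2) by (simp add: filter_on_def le_principal)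
  have "eventually P (filtermap f (preimage_filter X f H)) \<longleftrightarrow>
      (\<exists>Q. eventually Q H \<and> (\<forall>x\<in>X. Q (f x) \<longrightarrow> P (f x)))"
    by (auto simp: preimage_filter_def eventually_filtermap eventually_inf_principal
        eventually_filtercomap)
  also have "\<dots> \<longleftrightarrow> (\<exists>Q. eventually Q H \<and> (\<forall>y\<in>Y. Q y \<longrightarrow> P y))"
    using assms(1) by blast
  also have "\<dots> \<longleftrightarrow> eventually P H"
    using Y by (auto elim: eventually_elim2)
  finally show "eventually P (filtermap f (preimage_filter X f H)) \<longleftrightarrow> eventually P H" .
qed

text \<open>The graph sees only \<open>A \<inter> X\<close>, which is still a member of
  \<open>F\<close> whenever \<open>A\<close> is.\<close>

lemma rel_filter_image_graph_on:
  assumes "F \<le> principal X"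
  shows "rel_filter_image (graph_on X f) F = filtermap f F"
proof (rule antisym)
  have X: "eventually (\<lambda>x. x \<in> X) F" using assms by (simp add: le_principal)
  have im: "graph_on X f `` A = f ` (A \<inter> X)" for A by (auto simp: graph_on_def)
  show "rel_filter_image (graph_on X f) F \<le> filtermap f F"
  proof (rule filter_leI)
    fix P assume "eventually P (filtermap f F)"
    then have "eventually (\<lambda>x. x \<in> {x. P (f x)}) F" by (simp add: eventually_filtermap)
    then have "rel_filter_image (graph_on X f) F \<le> principal (graph_on X f `` {x. P (f x)})"
      unfolding rel_filter_image_def by (intro INF_lower) simp
    also have "\<dots> \<le> principal {y. P y}" by (auto simp: im)
    finally show "eventually P (rel_filter_image (graph_on X f) F)" by (simp add: le_principal)
  qed
  show "filtermap f F \<le> rel_filter_image (graph_on X f) F"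
    unfolding rel_filter_image_def
  proof (rule INF_greatest)
    fix A assume "A \<in> {A. eventually (\<lambda>x. x \<in> A) F}"
    then have "eventually (\<lambda>x. x \<in> A) F" by simp
    with X show "filtermap f F \<le> principal (graph_on X f `` A)"
      by (simp add: le_principal eventually_filtermap im) (auto elim: eventually_elim2)
  qed
qed

section \<open>Adherence and the final convergence\<close>

lemma convergence_on_proper:
  assumes "convergence_on X \<xi>" "x \<in> \<xi> F"
  shows "x \<in> X \<and> proper_filter_on X F"
proof -
  have "\<xi> F \<subseteq> X" "\<not> proper_filter_on X F \<longrightarrow> \<xi> F = {}"
    using assms(1) by (simp_all add: convergence_on_def)
  with assms(2) show ?thesis by blast
qed

lemma adh_subset: "convergence_on X \<xi> \<Longrightarrow> adh \<xi> F \<subseteq> X"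
  by (auto simp: adh_def dest: convergence_on_proper)

lemma adh_mono: "finer \<xi> \<theta> \<Longrightarrow> adh \<xi> F \<subseteq> adh \<theta> F"
  unfolding adh_def finer_def by (rule UN_mono) auto

lemma finer_final_convergence:
  assumes "convergence_on X \<xi>" "convergence_on Y \<tau>" "conv_continuous X \<xi> Y \<tau> f"
  shows "finer (final_convergence X \<xi> Y f) \<tau>"
proof -
  have "f ` X \<subseteq> Y" using assms(3) by (simp add: conv_continuous_def)
  from is_final_convergence_final_convergence[OF assms(1) this] assms(2,3) show ?thesis
    by (simp add: is_final_convergence_def)
qed

text \<open>
  The convergence for which \<open>G\<close> converges to \<open>y\<close> iff every \<open>H\<close> meshing with \<open>G\<close> has a point of
  \<open>f\<^sup>-(y)\<close> in \<open>adh\<^sub>\<xi> (f\<^sup>- H)\<close> makes \<open>f\<close> continuous, hence is coarser than the final one. This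
  avoids describing the final convergence by finite intersections of image filters.
\<close>

lemma adh_final_convergence:
  assumes \<xi>: "convergence_on X \<xi>" and f: "f ` X = Y"
  shows "adh (final_convergence X \<xi> Y f) H = f ` adh \<xi> (preimage_filter X f H)"
proof
  let ?\<sigma> = "final_convergence X \<xi> Y f"
  let ?\<theta> = "\<lambda>G. {y \<in> Y. proper_filter_on Y G \<and>
    (\<forall>H. mesh G H \<longrightarrow> y \<in> f ` adh \<xi> (preimage_filter X f H))}"
  have fX: "f ` X \<subseteq> Y" using f by simp
  have final: "is_final_convergence X \<xi> Y f ?\<sigma>"
    using is_final_convergence_final_convergence[OF \<xi> fX] .
  \<comment> \<open>Serves both the axiom for principal filters and the continuity of
    \<open>f\<close> into \<open>?\<theta>\<close>.\<close>
  have image: "f x \<in> f ` adh \<xi> (preimage_filter X f H)"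
    if "x \<in> \<xi> F" "mesh (filtermap f F) H" for x F H
  proof -
    have "F \<le> principal X"
      using convergence_on_proper[OF \<xi> that(1)] by (simp add: proper_filter_on_def filter_on_def)
    with that show ?thesis by (auto simp: adh_def mesh_filtermap_iff)
  qed
  have "convergence_on Y ?\<theta>"
    unfolding convergence_on_def
  proof (intro conjI allI impI ballI)
    show "?\<theta> F \<subseteq> ?\<theta> G"
      if "proper_filter_on Y F" "proper_filter_on Y G" "G \<le> F" for F G
      using that by (auto dest: mesh_mono)
    show "y \<in> ?\<theta> (principal {y})" if y: "y \<in> Y" for y
    proof -
      obtain x where "x \<in> X" "y = f x" using y f by blast
      moreover from this have "x \<in> \<xi> (principal {x})" using \<xi> by (simp add: convergence_on_def)
      ultimately show ?thesis
        using y image[of x "principal {x}"] by (simp add: proper_filter_on_principal_singleton)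
    qed
    show "?\<theta> (sup F G) = ?\<theta> F \<inter> ?\<theta> G"
      if "proper_filter_on Y F" "proper_filter_on Y G" for F G
      using that by (auto simp: mesh_sup_left proper_filter_on_sup)
  qed auto
  moreover have "conv_continuous X \<xi> Y ?\<theta> f"
    using fX image convergence_on_proper[OF \<xi>] proper_filter_on_filtermap[OF fX]
    by (auto simp: conv_continuous_def)
  ultimately have "finer ?\<sigma> ?\<theta>" using final by (simp add: is_final_convergence_def)
  \<comment> \<open>A filter witnessing adherence to \<open>H\<close> meshes with \<open>H\<close>,
    so the condition in \<open>?\<theta>\<close> is applied to this very \<open>H\<close>.\<close>
  then show "adh ?\<sigma> H \<subseteq> f ` adh \<xi> (preimage_filter X f H)"
    unfolding adh_def[of ?\<sigma>] finer_def by blast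
  show "f ` adh \<xi> (preimage_filter X f H) \<subseteq> adh ?\<sigma> H"
  proof
    fix y assume "y \<in> f ` adh \<xi> (preimage_filter X f H)"
    then obtain x G where x: "y = f x" "x \<in> \<xi> G" "mesh G (preimage_filter X f H)"
      by (auto simp: adh_def)
    have G: "proper_filter_on X G" using convergence_on_proper[OF \<xi> x(2)] by simp
    then have "y \<in> ?\<sigma> (filtermap f G)"
      using final x unfolding is_final_convergence_def conv_continuous_def by blast
    moreover have "mesh (filtermap f G) H"
      using G x(3) mesh_filtermap_iff by (auto simp: proper_filter_on_def filter_on_def)
    ultimately show "y \<in> adh ?\<sigma> H" by (auto simp: adh_def)
  qed
qed

text \<open>The fibre over \<open>y\<close> meets an adherence contained in \<open>X\<close> exactly
  when \<open>y\<close> lies in its image under \<open>f\<close>, and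
  \<open>adh_final_convergence\<close> identifies that image.\<close>

lemma quotient_map_for_iff:
  assumes \<xi>: "convergence_on X \<xi>" and \<tau>: "convergence_on Y \<tau>" and f: "f ` X = Y"
  shows "quotient_map_for \<M> X \<xi> Y \<tau> f \<longleftrightarrow>
    (\<forall>H \<in> \<M> Y. adh \<tau> H \<subseteq> adh (final_convergence X \<xi> Y f) H)"
proof -
  have "(X \<inter> f -` {y}) \<inter> adh \<xi> (preimage_filter X f H) \<noteq> {} \<longleftrightarrow>
      y \<in> adh (final_convergence X \<xi> Y f) H" for y H
    using adh_subset[OF \<xi>, of "preimage_filter X f H"]
    unfolding adh_final_convergence[OF \<xi> f] by auto
  then have "quotient_map_for \<M> X \<xi> Y \<tau> f \<longleftrightarrow>
      (\<forall>H \<in> \<M> Y. \<forall>y \<in> Y. y \<in> adh \<tau> H \<longrightarrow> y \<in> adh (final_convergence X \<xi> Y f) H)"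
    using f by (simp add: quotient_map_for_def)
  then show ?thesis
    using adh_subset[OF \<tau>] by (simp add: subset_iff) blast
qed

section \<open>The initial convergence, meshability of the graph and accessibility\<close>

text \<open>Replaces the \<open>THE\<close> description by a formula: the right-hand side defines a
  convergence making \<open>f\<close> continuous, hence finer than the coarsest such one, while
  continuity for the coarsest one gives the reverse comparison.\<close>

lemma mem_initial_convergence_iff:
  assumes \<tau>: "convergence_on Y \<tau>" and f: "f ` X \<subseteq> Y"
  shows "x \<in> initial_convergence X Y \<tau> f F \<longleftrightarrow>
    proper_filter_on X F \<and> x \<in> X \<and> f x \<in> \<tau> (filtermap f F)"
proof -
  let ?\<iota> = "initial_convergence X Y \<tau> f"
  let ?\<theta> = "\<lambda>F. {x \<in> X. proper_filter_on X F \<and> f x \<in> \<tau> (filtermap f F)}"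
  have initial: "is_initial_convergence X Y \<tau> f ?\<iota>"
    using is_initial_convergence_initial_convergence[OF \<tau> f] .
  have map: "proper_filter_on X F \<Longrightarrow> proper_filter_on Y (filtermap f F)" for F
    by (rule proper_filter_on_filtermap[OF f])
  have "convergence_on X ?\<theta>"
    unfolding convergence_on_def
  proof (intro conjI allI impI ballI)
    show "?\<theta> F \<subseteq> ?\<theta> G" if "proper_filter_on X F" "proper_filter_on X G" "G \<le> F" for F G
    proof -
      have "\<tau> (filtermap f F) \<subseteq> \<tau> (filtermap f G)"
        using \<tau> that map filtermap_mono[OF that(3), of f] by (simp add: convergence_on_def)
      then show ?thesis using that by auto
    qed
    show "x \<in> ?\<theta> (principal {x})" if "x \<in> X" for x
      using that \<tau> f by (auto simp: convergence_on_def proper_filter_on_principal_singleton)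
    show "?\<theta> (sup F G) = ?\<theta> F \<inter> ?\<theta> G"
      if "proper_filter_on X F" "proper_filter_on X G" for F G
      using \<tau> that map by (auto simp: convergence_on_def filtermap_sup proper_filter_on_sup)
  qed auto
  moreover have "conv_continuous X ?\<theta> Y \<tau> f"
    using f by (auto simp: conv_continuous_def)
  ultimately have "finer ?\<theta> ?\<iota>" using initial by (simp add: is_initial_convergence_def)
  moreover have "finer ?\<iota> ?\<theta>"
    unfolding finer_def
  proof (intro allI subsetI)
    fix F x assume x: "x \<in> ?\<iota> F"
    have \<iota>: "convergence_on X ?\<iota>" "conv_continuous X ?\<iota> Y \<tau> f"
      using initial by (simp_all add: is_initial_convergence_def)
    have F: "x \<in> X" "proper_filter_on X F"
      using convergence_on_proper[OF \<iota>(1) x] by simp_all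
    with \<iota>(2) x have "f x \<in> \<tau> (filtermap f F)" by (auto simp: conv_continuous_def)
    with F show "x \<in> ?\<theta> F" by simp
  qed
  ultimately show ?thesis unfolding finer_def by blast
qed

text \<open>Eliminates \<open>X\<close>: by surjectivity, the filters converging to \<open>y\<close>
  in \<open>\<tau>\<close> are exactly the images of filters converging initially to a point over
  \<open>y\<close>.\<close>

lemma compactly_meshable_graph_iff:
  assumes \<tau>: "convergence_on Y \<tau>" and f: "f ` X = Y"
  shows "compactly_meshable_rel \<M> \<J> \<D> X (initial_convergence X Y \<tau> f) Y \<sigma> (graph_on X f) \<longleftrightarrow>
    (\<forall>J \<in> \<J> Y. \<forall>y \<in> adh \<tau> J. \<exists>D \<in> \<D> Y. mesh D J \<and> compact_at \<M> Y \<sigma> D {y})"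
    (is "?L \<longleftrightarrow> ?R")
proof -
  let ?\<iota> = "initial_convergence X Y \<tau> f"
  have fX: "f ` X \<subseteq> Y" using f by simp
  note mem = mem_initial_convergence_iff[OF \<tau> fX]
  have image: "rel_filter_image (graph_on X f) F = filtermap f F \<and> graph_on X f `` {x} = {f x}"
    if "x \<in> ?\<iota> F" for x F
  proof
    have F: "F \<le> principal X" "x \<in> X"
      using that by (auto simp: mem proper_filter_on_def filter_on_def)
    show "rel_filter_image (graph_on X f) F = filtermap f F"
      by (rule rel_filter_image_graph_on[OF F(1)])
    show "graph_on X f `` {x} = {f x}" using F(2) by (auto simp: graph_on_def)
  qed
  have "?L \<longleftrightarrow> (\<forall>F x. x \<in> ?\<iota> F \<longrightarrow> compactly_meshable_at \<M> \<J> \<D> Y \<sigma> (filtermap f F) {f x})"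
    using image fX by (auto simp: compactly_meshable_rel_def graph_on_def)
  also have "\<dots> \<longleftrightarrow> (\<forall>G y. y \<in> \<tau> G \<longrightarrow> compactly_meshable_at \<M> \<J> \<D> Y \<sigma> G {y})"
  proof (intro iffI allI impI)
    fix G y
    assume *: "\<forall>F x. x \<in> ?\<iota> F \<longrightarrow> compactly_meshable_at \<M> \<J> \<D> Y \<sigma> (filtermap f F) {f x}"
      and y: "y \<in> \<tau> G"
    have G: "y \<in> Y" "filter_on Y G" "G \<noteq> bot"
      using convergence_on_proper[OF \<tau> y] by (auto simp: proper_filter_on_def)
    obtain x where x: "x \<in> X" "y = f x" using G(1) f by blast
    \<comment> \<open>This lift of \<open>G\<close> has image \<open>G\<close>, so it is proper and
      converges initially to every point over \<open>y\<close>.\<close>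
    let ?F = "preimage_filter X f G"
    have map: "filtermap f ?F = G" using filtermap_preimage_filter[OF f G(2)] .
    then have "proper_filter_on X ?F"
      using G(3) filtermap_bot[of f]
      by (auto simp: proper_filter_on_def filter_on_def preimage_filter_def)
    then have "x \<in> ?\<iota> ?F" using x y map by (simp add: mem)
    with * x map show "compactly_meshable_at \<M> \<J> \<D> Y \<sigma> G {y}" by metis
  qed (simp add: mem)
  \<comment> \<open>\<open>G\<close> enters only through \<open>y \<in> \<tau> G\<close> and
    \<open>mesh J G\<close>, so quantifying over it amounts to
    \<open>y \<in> adh \<tau> J\<close>.\<close>
  also have "\<dots> \<longleftrightarrow> ?R"
    unfolding compactly_meshable_at_def adh_def using mesh_commute by fast
  finally show ?thesis .
qed

text \<open>A filter converging for \<open>Base\<close> can be enlarged in the library order to some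
  \<open>D\<close> of the class, which still meshes with \<open>J\<close>; conversely
  \<open>D\<close> is its own base.\<close>

lemma mem_adh_Base_iff:
  assumes \<tau>: "convergence_on Y \<tau>"
  shows "y \<in> adh (Base Y \<D> \<tau>) J \<longleftrightarrow> (\<exists>D \<in> \<D> Y. mesh D J \<and> y \<in> \<tau> D)"
proof
  assume "y \<in> adh (Base Y \<D> \<tau>) J"
  then show "\<exists>D \<in> \<D> Y. mesh D J \<and> y \<in> \<tau> D"
    by (auto simp: adh_def Base_def split: if_splits intro: mesh_mono)
next
  assume "\<exists>D \<in> \<D> Y. mesh D J \<and> y \<in> \<tau> D"
  then obtain D where D: "D \<in> \<D> Y" "mesh D J" "y \<in> \<tau> D" by blast
  then have "y \<in> Base Y \<D> \<tau> D"
    using convergence_on_proper[OF \<tau> D(3)] by (auto simp: Base_def)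
  with D show "y \<in> adh (Base Y \<D> \<tau>) J" by (auto simp: adh_def)
qed

theorem theorem16:
  fixes X :: "'a set" and Y :: "'b set"
    and \<xi> :: "'a convergence" and \<tau> :: "'b convergence"
    and f :: "'a \<Rightarrow> 'b"
    and \<M> \<J> \<D> :: "'b filter_class"
  assumes "is_filter_class \<M>" and "is_filter_class \<J>" and "is_filter_class \<D>"
    and "subclass_of \<M> \<J>"
    and "convergence_on X \<xi>" and "convergence_on Y \<tau>"
    and "\<tau> = Adh Y \<M> \<tau>"
    and "conv_continuous X \<xi> Y \<tau> f" and "f ` X = Y"
  shows "quotient_map_for \<M> X \<xi> Y \<tau> f \<and> accessible \<J> \<D> Y \<tau> \<longleftrightarrow>
    compactly_meshable_rel \<M> \<J> \<D>
      X (initial_convergence X Y \<tau> f) Y (final_convergence X \<xi> Y f) (graph_on X f)"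
proof -
  let ?\<sigma> = "final_convergence X \<xi> Y f"
  note \<tau> = assms(6)
  have quotient: "quotient_map_for \<M> X \<xi> Y \<tau> f \<longleftrightarrow> (\<forall>H \<in> \<M> Y. adh \<tau> H \<subseteq> adh ?\<sigma> H)"
    by (rule quotient_map_for_iff[OF assms(5) \<tau> assms(9)])
  have accessible: "accessible \<J> \<D> Y \<tau> \<longleftrightarrow>
      (\<forall>J \<in> \<J> Y. \<forall>y \<in> adh \<tau> J. \<exists>D \<in> \<D> Y. mesh D J \<and> y \<in> \<tau> D)"
    using mem_adh_Base_iff[OF \<tau>, of _ \<D>] by (auto simp: accessible_def subset_iff)
  have lim_compact: "compact_at \<M> Y ?\<sigma> D {y}"
    if "\<forall>H \<in> \<M> Y. adh \<tau> H \<subseteq> adh ?\<sigma> H" "y \<in> \<tau> D" for D y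
    unfolding compact_at_def
  proof (intro ballI impI)
    fix M assume M: "M \<in> \<M> Y" "mesh M D"
    \<comment> \<open>\<open>D\<close> itself witnesses the adherence.\<close>
    then have "y \<in> adh \<tau> M" using that(2) mesh_commute by (fastforce simp: adh_def)
    with that(1) M(1) show "adh ?\<sigma> M \<inter> {y} \<noteq> {}" by blast
  qed
  have compact_lim: "y \<in> \<tau> D"
    if D: "D \<in> \<D> Y" "mesh D J" and y: "y \<in> Y" and compact: "compact_at \<M> Y ?\<sigma> D {y}" for D J y
  proof -
    \<comment> \<open>\<open>bot\<close> belongs to every class and is vacuously compact at
      \<open>{y}\<close>; meshing with \<open>J\<close> excludes it.\<close>
    have "proper_filter_on Y D"
      using D assms(3) mesh_imp_neq_bot by (auto simp: is_filter_class_def proper_filter_on_def)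
    \<comment> \<open>Adherence grows from \<open>?\<sigma>\<close> to the coarser
      \<open>\<tau>\<close>.\<close>
    moreover have "y \<in> adh \<tau> M" if "M \<in> \<M> Y" "mesh M D" for M
      using compact that adh_mono[OF finer_final_convergence[OF assms(5) \<tau> assms(8)], of M]
      by (auto simp: compact_at_def)
    ultimately have "y \<in> Adh Y \<M> \<tau> D" using y by (simp add: Adh_def)
    then show ?thesis using assms(7) by simp
  qed
  show ?thesis
    unfolding compactly_meshable_graph_iff[OF \<tau> assms(9)] quotient accessible
  proof (intro iffI conjI)
    assume "(\<forall>H \<in> \<M> Y. adh \<tau> H \<subseteq> adh ?\<sigma> H) \<and>
      (\<forall>J \<in> \<J> Y. \<forall>y \<in> adh \<tau> J. \<exists>D \<in> \<D> Y. mesh D J \<and> y \<in> \<tau> D)"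
    then show "\<forall>J \<in> \<J> Y. \<forall>y \<in> adh \<tau> J. \<exists>D \<in> \<D> Y. mesh D J \<and> compact_at \<M> Y ?\<sigma> D {y}"
      using lim_compact by blast
  next
    assume *: "\<forall>J \<in> \<J> Y. \<forall>y \<in> adh \<tau> J. \<exists>D \<in> \<D> Y. mesh D J \<and> compact_at \<M> Y ?\<sigma> D {y}"
    show "\<forall>H \<in> \<M> Y. adh \<tau> H \<subseteq> adh ?\<sigma> H"
    proof (intro ballI subsetI)
      fix H y assume H: "H \<in> \<M> Y" and y: "y \<in> adh \<tau> H"
      \<comment> \<open>Here \<open>H\<close> plays two roles: as a member of \<open>\<J> Y\<close>
        it produces a compact \<open>D\<close> meshing with it, and as a member of
        \<open>\<M> Y\<close> it tests the compactness of that \<open>D\<close>.\<close>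
      then have "H \<in> \<J> Y" using assms(4) by (auto simp: subclass_of_def)
      then obtain D where "mesh D H" "compact_at \<M> Y ?\<sigma> D {y}" using * y by blast
      then have "adh ?\<sigma> H \<inter> {y} \<noteq> {}" using H mesh_commute unfolding compact_at_def by blast
      then show "y \<in> adh ?\<sigma> H" by blast
    qed
    show "\<forall>J \<in> \<J> Y. \<forall>y \<in> adh \<tau> J. \<exists>D \<in> \<D> Y. mesh D J \<and> y \<in> \<tau> D"
      using * compact_lim adh_subset[OF \<tau>] by (meson subsetD)
  qed
qed

end
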